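(* Let $n\ge3$, $m\ge2$, and let $f_1,\ldots,f_m$ be quadratic functions on $\mathbb{R}^n$, $f_i(x)=x^\top A_ix+2b_i^\top x+c_i$, with associated matrices $Q_i=\begin{bmatrix}A_i & b_i\\ b_i^\top & c_i\end{bmatrix}$. Let $T=\{x\in\mathbb{R}^n:f_i(x)\le0,\ i\in[m]\}$ and $G=\mathrm{int}\big(\overline{\mathrm{conv}(T)}\big)$. Assume that $Q_1,\ldots,Q_m$ satisfy hidden hyperplane convexity, that $\emptyset\subsetneq G\subsetneq\mathbb{R}^n$, and furthermore that $Q_\lambda\ne0$ for all nonzero $\lambda\ge0$ in $\mathbb{R}^m$. Then $$G=\bigcap_{\lambda\in\Omega_T}S_\lambda,$$ where $S_\lambda=\{x\in\mathbb{R}^n:\sum_{i=1}^m\lambda_if_i(x)<0\}$ and $\Omega_T\subseteq\mathbb{R}^m_+\setminus\{0\}$ is the set of $\lambda$ such that $Q_\lambda=\sum_{i=1}^m\lambda_iQ_i$ has at most one negative eigenvalue and $G\subseteq S_\lambda$.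
   Context: $[m]=\{1,\dots,m\}$; $A_i$ are symmetric real $n\times n$ matrices, $b_i\in\mathbb{R}^n$, $c_i\in\mathbb{R}$; $\mathbb{R}^m_+$ is the nonnegative orthant; $\mathrm{int}$ and the overline denote topological interior and closure in $\mathbb{R}^n$. The symmetric $(n+1)\times(n+1)$ matrices $Q_1,\ldots,Q_m$ satisfy hidden hyperplane convexity if for every linear hyperplane ($n$-dimensional linear subspace) $H\subseteq\mathbb{R}^{n+1}$ the set $\{(\hat x^\top Q_1\hat x,\ldots,\hat x^\top Q_m\hat x):\hat x\in H\}\subseteq\mathbb{R}^m$ is convex. *)

theory Defs
  imports "HOL-Analysis.Analysis"
begin

definition quadratic_fun :: "real^'n^'n \<Rightarrow> real^'n \<Rightarrow> real \<Rightarrow> real^'n \<Rightarrow> real"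
  where "quadratic_fun A b c x = x \<bullet> (A *v x) + 2 * (b \<bullet> x) + c"

(* Matrices of size n + 1 are indexed by 'n option: Some i are the first n
   coordinates and None is the last one, so this is the block matrix with rows
   (A, b) and (b transposed, c). *)
definition quadratic_matrix ::
    "real^'n^'n \<Rightarrow> real^'n \<Rightarrow> real \<Rightarrow> real^('n option)^('n option)"
  where "quadratic_matrix A b c = (\<chi> r s. case r of
      Some i \<Rightarrow> (case s of Some j \<Rightarrow> A $ i $ j | None \<Rightarrow> b $ i)
    | None \<Rightarrow> (case s of Some j \<Rightarrow> b $ j | None \<Rightarrow> c))"

definition hidden_hyperplane_convex :: "('m::finite \<Rightarrow> real^'k^'k) \<Rightarrow> bool"
  where "hidden_hyperplane_convex Q \<longleftrightarrow>
    (\<forall>H :: (real^'k) set. subspace H \<and> dim H + 1 = CARD('k) \<longrightarrow>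
       convex ((\<lambda>x. (\<chi> i. x \<bullet> (Q i *v x)) :: real^'m) ` H))"

definition matrix_aggregate :: "('m::finite \<Rightarrow> real^'k^'k) \<Rightarrow> real^'m \<Rightarrow> real^'k^'k"
  where "matrix_aggregate Q l = (\<Sum>i\<in>UNIV. (l $ i) *\<^sub>R Q i)"

definition aggregate_set :: "('m::finite \<Rightarrow> real^'n \<Rightarrow> real) \<Rightarrow> real^'m \<Rightarrow> (real^'n) set"
  where "aggregate_set f l = {x. (\<Sum>i\<in>UNIV. l $ i * f i x) < 0}"

definition eigenspace :: "real^'k^'k \<Rightarrow> real \<Rightarrow> (real^'k) set"
  where "eigenspace M \<mu> = {v. M *v v = \<mu> *\<^sub>R v}"

definition eigenvalues :: "real^'k^'k \<Rightarrow> real set"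
  where "eigenvalues M = {\<mu>. \<exists>v. v \<noteq> 0 \<and> v \<in> eigenspace M \<mu>}"

(* Eigenvalues are counted with multiplicity. This is used for symmetric
   matrices only, where the dimension of the eigenspace is also the algebraic
   multiplicity; the index set of the sum is finite by finite_eigenvalues. *)
definition num_neg_eigenvalues :: "real^'k^'k \<Rightarrow> nat"
  where "num_neg_eigenvalues M = (\<Sum>\<mu>\<in>{\<mu> \<in> eigenvalues M. \<mu> < 0}. dim (eigenspace M \<mu>))"

lemma finite_eigenvalues:
  fixes M :: "real^'k^'k"
  assumes sym: "transpose M = M"
  shows "finite (eigenvalues M)"
proof -
  have "\<forall>\<mu>\<in>eigenvalues M. \<exists>v. v \<noteq> 0 \<and> M *v v = \<mu> *\<^sub>R v"
    by (auto simp: eigenvalues_def eigenspace_def)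
  then obtain v where v: "\<And>\<mu>. \<mu> \<in> eigenvalues M \<Longrightarrow> v \<mu> \<noteq> 0 \<and> M *v v \<mu> = \<mu> *\<^sub>R v \<mu>"
    by metis
  have orth: "v \<mu> \<bullet> v \<nu> = 0"
    if "\<mu> \<in> eigenvalues M" "\<nu> \<in> eigenvalues M" "\<mu> \<noteq> \<nu>" for \<mu> \<nu>
  proof -
    have "(M *v v \<mu>) \<bullet> v \<nu> = v \<mu> \<bullet> (M *v v \<nu>)"
      by (metis dot_lmul_matrix sym vector_transpose_matrix)
    then have "(\<mu> - \<nu>) * (v \<mu> \<bullet> v \<nu>) = 0"
      using v that by (simp add: algebra_simps)
    then show ?thesis using that by simp
  qed
  have "inj_on v (eigenvalues M)"
    by (rule inj_onI) (metis orth v inner_eq_zero_iff)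
  moreover have "independent (v ` eigenvalues M)"
    using orth v
    by (intro pairwise_orthogonal_independent)
      (auto simp: pairwise_def orthogonal_def)
  then have "finite (v ` eigenvalues M)"
    by (rule finiteI_independent)
  ultimately show ?thesis by (rule finite_imageD[rotated])
qed

end

theory Submission
  imports Defs
begin

text \<open>
  Only one inclusion has content: every point \<open>y\<close> outside \<open>G\<close> must be missed by some
  \<open>S\<^sub>\<lambda>\<close> with \<open>\<lambda> \<in> \<Omega>\<close>.  Separate \<open>y\<close> from \<open>T\<close> by a normal vector \<open>a\<close>, so that
  \<open>a \<bullet> x \<le> \<beta> = a \<bullet> y\<close> on \<open>T\<close>, and pass to homogeneous coordinates \<open>(x, t)\<close>, in which
  \<open>a \<bullet> x = \<gamma>\<close> becomes a linear hyperplane \<open>H\<^sub>\<gamma>\<close>.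

  For \<open>\<gamma> > \<beta>\<close> the hyperplane misses \<open>T\<close>, so no vector of \<open>H\<^sub>\<gamma>\<close> makes all the forms \<open>Q\<^sub>i\<close>
  negative.  By hidden hyperplane convexity the joint image of \<open>H\<^sub>\<gamma>\<close> is a convex set which avoids
  the open negative orthant, and separating the two gives \<open>\<lambda> \<ge> 0\<close> with \<open>Q\<^sub>\<lambda>\<close> positive
  semidefinite on \<open>H\<^sub>\<gamma>\<close> (\<open>exists_aggregate_psd_on_hyperplane\<close>).  Such a form behaves like a
  Lorentzian form: on each open side of \<open>H\<^sub>\<gamma>\<close> the vectors where it is nonpositive form a
  convex cone (\<open>psd_on_hyperplane_same_side\<close>).  As \<open>T\<close> lies strictly on one side, the closed convex hull of
  \<open>T\<close>, and hence \<open>G\<close>, satisfies \<open>f\<^sub>\<lambda> \<le> 0\<close>.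

  The strict inequality \<open>\<gamma> > \<beta>\<close> matters: for \<open>\<gamma> = \<beta>\<close> the set \<open>T\<close> may touch \<open>H\<^sub>\<gamma>\<close>, and
  the convexity argument, which concerns the open side only, would not control \<open>f\<^sub>\<lambda>\<close> on the
  convex hull of \<open>T\<close>.  Normalising \<open>\<lambda>\<close> and letting
  \<open>\<gamma>\<close> decrease to \<open>\<beta>\<close>, compactness of the sphere yields a \<open>\<lambda>\<close> with \<open>Q\<^sub>\<lambda>\<close> positive
  semidefinite on \<open>H\<^sub>\<beta>\<close> and still \<open>f\<^sub>\<lambda> \<le> 0\<close> on \<open>G\<close>.  The first property gives
  \<open>f\<^sub>\<lambda> y \<ge> 0\<close> and at most one negative eigenvalue (\<open>psd_on_hyperplane_num_neg_eigenvalues\<close>).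
  If \<open>f\<^sub>\<lambda>\<close> vanished at a point of the open set \<open>G\<close>, it would have a local maximum there; then
  \<open>Q\<^sub>\<lambda>\<close> would be negative semidefinite with that point, which is off \<open>H\<^sub>\<beta>\<close>, in its kernel,
  so \<open>Q\<^sub>\<lambda> = 0\<close> (\<open>psd_on_hyperplane_local_max_imp_zero\<close>).
\<close>

section \<open>Quadratic forms that are nonnegative on a hyperplane\<close>

lemma symmetric_inner_commute:
  fixes M :: "real^'k^'k"
  assumes "transpose M = M"
  shows "u \<bullet> (M *v v) = v \<bullet> (M *v u)"
  by (metis assms dot_lmul_matrix inner_commute vector_transpose_matrix)

lemma quadratic_form_scaleR:
  fixes M :: "real^'k^'k"
  shows "(r *\<^sub>R v) \<bullet> (M *v (r *\<^sub>R v)) = r\<^sup>2 * (v \<bullet> (M *v v))"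
  by (simp add: matrix_vector_mult_scaleR power2_eq_square)

lemma quadratic_form_add:
  fixes M :: "real^'k^'k"
  assumes "transpose M = M"
  shows "(u + s *\<^sub>R v) \<bullet> (M *v (u + s *\<^sub>R v)) =
    u \<bullet> (M *v u) + 2 * s * (u \<bullet> (M *v v)) + s\<^sup>2 * (v \<bullet> (M *v v))"
  using symmetric_inner_commute[OF assms, of u v]
  by (simp add: matrix_vector_right_distrib matrix_vector_mult_scaleR inner_add_left
      inner_add_right power2_eq_square algebra_simps)

lemma symmetric_quadratic_form_zero_imp_zero:
  fixes M :: "real^'k^'k"
  assumes sym: "transpose M = M" and zero: "\<And>w. w \<bullet> (M *v w) = 0"
  shows "M = 0"
proof -
  have "u \<bullet> (M *v v) = 0" for u v
    using quadratic_form_add[OF sym, of u 1 v] zero by simp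
  then have "M *v v = 0" for v
    by (metis inner_eq_zero_iff)
  then show ?thesis
    by (simp add: matrix_eq)
qed

text \<open>The reverse Cauchy--Schwarz argument: a combination \<open>u - s v\<close> with \<open>s > 0\<close> lies on the
  hyperplane, and a positive mixed term would make the form negative there.\<close>

lemma psd_on_hyperplane_same_side:
  fixes M :: "real^'k^'k"
  assumes sym: "transpose M = M"
    and psd: "\<And>w. p \<bullet> w = 0 \<Longrightarrow> 0 \<le> w \<bullet> (M *v w)"
    and u: "p \<bullet> u < 0" "u \<bullet> (M *v u) \<le> 0"
    and v: "p \<bullet> v < 0" "v \<bullet> (M *v v) \<le> 0"
  shows "u \<bullet> (M *v v) \<le> 0"
proof -
  define s where "s = (p \<bullet> u) / (p \<bullet> v)"
  have s: "s > 0" using u v by (simp add: s_def divide_neg_neg)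
  have "p \<bullet> (u + (-s) *\<^sub>R v) = 0"
    using v by (simp add: s_def inner_add_right inner_diff_right)
  from psd[OF this] have "0 \<le> u \<bullet> (M *v u) - 2 * s * (u \<bullet> (M *v v)) + s\<^sup>2 * (v \<bullet> (M *v v))"
    using quadratic_form_add[OF sym, of u "-s" v] by simp
  moreover have "s\<^sup>2 * (v \<bullet> (M *v v)) \<le> 0"
    using v by (simp add: mult_nonneg_nonpos)
  ultimately have "s * (u \<bullet> (M *v v)) \<le> 0" using u by linarith
  then show ?thesis using s by (simp add: mult_le_0_iff)
qed

text \<open>The span of all eigenvectors for negative eigenvalues is negative definite, so it meets the
  hyperplane only in zero and has dimension at most one.\<close>

lemma psd_on_hyperplane_num_neg_eigenvalues:
  fixes M :: "real^'k^'k"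
  assumes sym: "transpose M = M"
    and psd: "\<And>w. p \<bullet> w = 0 \<Longrightarrow> 0 \<le> w \<bullet> (M *v w)"
  shows "num_neg_eigenvalues M \<le> 1"
proof -
  let ?N = "{\<mu> \<in> eigenvalues M. \<mu> < 0}"
  have off: "p \<bullet> v \<noteq> 0" if "M *v v = \<mu> *\<^sub>R v" "\<mu> < 0" "v \<noteq> 0" for \<mu> v
  proof
    assume "p \<bullet> v = 0"
    from psd[OF this] have "0 \<le> \<mu> * (v \<bullet> v)" using that by simp
    then show False using that by (metis inner_gt_zero_iff mult_neg_pos not_le)
  qed
  have dim1: "dim (eigenspace M \<mu>) \<le> 1" if mu: "\<mu> < 0" for \<mu>
  proof (cases "eigenspace M \<mu> \<subseteq> {0}")
    case True
    then show ?thesis by (metis dim_eq_0 zero_le)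
  next
    case False
    then obtain u where u: "M *v u = \<mu> *\<^sub>R u" "u \<noteq> 0" by (auto simp: eigenspace_def)
    have "eigenspace M \<mu> \<subseteq> span {u}"
    proof
      fix v assume "v \<in> eigenspace M \<mu>"
      then have v: "M *v v = \<mu> *\<^sub>R v" by (simp add: eigenspace_def)
      define r where "r = (p \<bullet> v) / (p \<bullet> u)"
      let ?w = "v - r *\<^sub>R u"
      have "M *v ?w = \<mu> *\<^sub>R ?w"
        using u v by (simp add: matrix_vector_mult_diff_distrib matrix_vector_mult_scaleR
            algebra_simps)
      moreover have "p \<bullet> ?w = 0"
        using off[OF u(1) mu u(2)] by (simp add: r_def inner_diff_right)
      ultimately have "?w = 0" using off mu by blast
      then show "v \<in> span {u}" by (auto simp: span_singleton)
    qed
    then have "dim (eigenspace M \<mu>) \<le> card {u}" by (intro dim_le_card) auto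
    then show ?thesis by simp
  qed
  have uniq: "\<mu> = \<nu>" if N: "\<mu> \<in> ?N" "\<nu> \<in> ?N" for \<mu> \<nu>
  proof (rule ccontr)
    assume ne: "\<mu> \<noteq> \<nu>"
    obtain u v where u: "M *v u = \<mu> *\<^sub>R u" "u \<noteq> 0" and v: "M *v v = \<nu> *\<^sub>R v" "v \<noteq> 0"
      using N by (auto simp: eigenvalues_def eigenspace_def)
    have "\<nu> * (u \<bullet> v) = \<mu> * (u \<bullet> v)"
      using symmetric_inner_commute[OF sym, of u v] u v by (simp add: inner_commute)
    then have uv: "u \<bullet> v = 0" using ne by simp
    define s where "s = - (p \<bullet> u) / (p \<bullet> v)"
    have "p \<bullet> (u + s *\<^sub>R v) = 0"
      using off[OF v(1) _ v(2)] N by (simp add: s_def inner_add_right inner_diff_right)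
    from psd[OF this] have "0 \<le> \<mu> * (u \<bullet> u) + s\<^sup>2 * (\<nu> * (v \<bullet> v))"
      using quadratic_form_add[OF sym, of u s v] u v uv by simp
    moreover have "\<mu> * (u \<bullet> u) < 0" using N u by (simp add: mult_neg_pos)
    moreover have "s\<^sup>2 * (\<nu> * (v \<bullet> v)) \<le> 0"
      using N by (intro mult_nonneg_nonpos mult_nonpos_nonneg) auto
    ultimately show False by linarith
  qed
  show ?thesis
  proof (cases "?N = {}")
    case False
    then obtain \<mu> where "?N = {\<mu>}" using uniq by blast
    then show ?thesis
      unfolding num_neg_eigenvalues_def using dim1[of \<mu>] by auto
  next
    case True
    then show ?thesis unfolding num_neg_eigenvalues_def by (metis sum.empty zero_le)
  qed
qed

lemma quadratic_form_local_max:
  fixes M :: "real^'k^'k"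
  assumes sym: "transpose M = M"
    and zero: "u \<bullet> (M *v u) = 0"
    and U: "open U" "u \<in> U" "\<And>w. w \<in> U \<Longrightarrow> w \<bullet> (M *v w) \<le> 0"
  shows "u \<bullet> (M *v w) = 0" "w \<bullet> (M *v w) \<le> 0"
proof -
  let ?B = "u \<bullet> (M *v w)" and ?q = "w \<bullet> (M *v w)"
  have "((\<lambda>s. u + s *\<^sub>R w) \<longlongrightarrow> u + 0 *\<^sub>R w) (at 0)"
    by (intro tendsto_intros)
  then have "\<forall>\<^sub>F s in at 0. u + s *\<^sub>R w \<in> U"
    using U by (simp add: topological_tendstoD)
  then obtain d where d: "d > 0" "\<And>s. s \<noteq> 0 \<Longrightarrow> \<bar>s\<bar> < d \<Longrightarrow> u + s *\<^sub>R w \<in> U"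
    by (auto simp: eventually_at dist_real_def)
  have le: "2 * s * ?B + s\<^sup>2 * ?q \<le> 0" if "s \<noteq> 0" "\<bar>s\<bar> < d" for s
    using U(3)[OF d(2)[OF that]] quadratic_form_add[OF sym, of u s w] zero by simp
  show q: "?q \<le> 0"
  proof -
    have "(d/2)\<^sup>2 * ?q \<le> 0" using le[of "d/2"] le[of "-(d/2)"] d(1) by simp
    then show ?thesis using d(1) by (simp add: mult_le_0_iff)
  qed
  \<comment> \<open>Dividing by \<open>s\<close> and letting \<open>s\<close> tend to 0 from either side bounds the mixed term both ways.\<close>
  have one_side: "\<sigma> * ?B \<le> 0" if "\<bar>\<sigma>\<bar> = 1" for \<sigma>
  proof (rule tendsto_upperbound)
    show "((\<lambda>s. \<sigma> * ?B + s * ?q / 2) \<longlongrightarrow> \<sigma> * ?B) (at_right 0)"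
      by (auto intro!: tendsto_eq_intros)
    have "\<sigma> * ?B + s * ?q / 2 \<le> 0" if s: "0 < s" "s < d" for s
    proof -
      have "\<sigma>\<^sup>2 = 1" using \<open>\<bar>\<sigma>\<bar> = 1\<close> by (simp add: abs_square_eq_1)
      moreover have "\<sigma> * s \<noteq> 0" "\<bar>\<sigma> * s\<bar> < d"
        using s \<open>\<bar>\<sigma>\<bar> = 1\<close> by (auto simp: abs_mult)
      ultimately have "2 * (\<sigma> * s) * ?B + s\<^sup>2 * ?q \<le> 0"
        using le[of "\<sigma> * s"] by (simp add: power_mult_distrib)
      then have "s * (\<sigma> * ?B + s * ?q / 2) \<le> 0"
        by (simp add: power2_eq_square algebra_simps)
      then show ?thesis using s by (simp add: mult_le_0_iff)
    qed
    then show "\<forall>\<^sub>F s in at_right 0. \<sigma> * ?B + s * ?q / 2 \<le> 0"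
      using d(1) by (auto simp: eventually_at_right intro: exI[of _ d])
  qed simp
  show "?B = 0" using one_side[of 1] one_side[of "-1"] by simp
qed

text \<open>At a local maximum with value zero the form is negative semidefinite and \<open>u\<close> is in its
  kernel; since \<open>u\<close> and the hyperplane, on which the form now vanishes, span the space, nothing
  is left.\<close>

lemma psd_on_hyperplane_local_max_imp_zero:
  fixes M :: "real^'k^'k"
  assumes sym: "transpose M = M"
    and psd: "\<And>w. p \<bullet> w = 0 \<Longrightarrow> 0 \<le> w \<bullet> (M *v w)"
    and u: "p \<bullet> u \<noteq> 0" "u \<bullet> (M *v u) = 0"
    and U: "open U" "u \<in> U" "\<And>w. w \<in> U \<Longrightarrow> w \<bullet> (M *v w) \<le> 0"
  shows "M = 0"
proof (rule symmetric_quadratic_form_zero_imp_zero[OF sym])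
  fix w
  note lm = quadratic_form_local_max[OF sym u(2) U]
  define s where "s = (p \<bullet> w) / (p \<bullet> u)"
  let ?h = "w - s *\<^sub>R u"
  have "p \<bullet> ?h = 0" using u by (simp add: s_def inner_diff_right)
  then have "?h \<bullet> (M *v ?h) = 0" using psd lm(2) by (metis order_antisym)
  moreover have "?h \<bullet> (M *v u) = 0" using lm(1) symmetric_inner_commute[OF sym] by metis
  ultimately show "w \<bullet> (M *v w) = 0"
    using quadratic_form_add[OF sym, of ?h s u] u by simp
qed

section \<open>Aggregates and separation on a hyperplane\<close>

definition joint_form :: "('m::finite \<Rightarrow> real^'k^'k) \<Rightarrow> real^'k \<Rightarrow> real^'m"
  where "joint_form Q v = (\<chi> i. v \<bullet> (Q i *v v))"

lemma quadratic_form_aggregate: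
  "v \<bullet> (matrix_aggregate Q l *v v) = l \<bullet> joint_form Q v"
proof -
  have "(\<Sum>i\<in>S. (l $ i) *\<^sub>R Q i) *v v = (\<Sum>i\<in>S. (l $ i) *\<^sub>R (Q i *v v))" for S
    by (induction S rule: infinite_finite_induct)
      (simp_all add: matrix_vector_mult_add_rdistrib scaleR_matrix_vector_assoc)
  then show ?thesis
    by (simp add: matrix_aggregate_def joint_form_def inner_vec_def[of l] inner_sum_right)
qed

lemma transpose_matrix_aggregate:
  assumes "\<And>i. transpose (Q i) = Q i"
  shows "transpose (matrix_aggregate Q l) = matrix_aggregate Q l"
proof -
  have "Q i $ r $ s = Q i $ s $ r" for i r s
    using arg_cong[OF assms[of i], of "\<lambda>M. M $ s $ r"] by (simp add: transpose_def)
  then show ?thesis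
    by (simp add: matrix_aggregate_def transpose_def vec_eq_iff)
qed

text \<open>The bound \<open>a \<bullet> x \<le> b\<close> extends to the closed orthant, where \<open>0\<close> and the vectors
  \<open>- axis i 1\<close> give the two claims.\<close>

lemma bounded_on_negative_orthant:
  fixes a :: "real^'m::finite"
  assumes le: "\<And>x. (\<forall>i. x $ i < 0) \<Longrightarrow> a \<bullet> x \<le> b" and b: "b \<le> 0"
  shows "0 \<le> b" "0 \<le> a $ i"
proof -
  have closed: "a \<bullet> x \<le> b" if x: "\<forall>i. x $ i \<le> 0" for x
  proof (rule tendsto_upperbound)
    show "((\<lambda>d. a \<bullet> (x - d *\<^sub>R 1)) \<longlongrightarrow> a \<bullet> x) (at_right 0)"
      by (auto intro!: tendsto_eq_intros)
    have "a \<bullet> (x - d *\<^sub>R 1) \<le> b" if "d > 0" for d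
    proof (rule le, rule allI)
      fix i show "(x - d *\<^sub>R 1) $ i < 0" using x[rule_format, of i] that by simp
    qed
    then show "\<forall>\<^sub>F d in at_right 0. a \<bullet> (x - d *\<^sub>R 1) \<le> b"
      using eventually_at_right_less[of "0::real"] by (rule eventually_mono[rotated])
  qed simp
  show "0 \<le> b" using closed[of 0] by simp
  have "a \<bullet> - axis i 1 \<le> b" by (rule closed) (simp add: axis_def)
  then show "0 \<le> a $ i" using b by (simp add: inner_axis)
qed

text \<open>Normalising the multiplier keeps it in a compact set, as the limit argument requires.\<close>

lemma exists_aggregate_psd_on_hyperplane:
  fixes Q :: "'m::finite \<Rightarrow> real^'k^'k"
  assumes HHC: "hidden_hyperplane_convex Q"
    and p: "p \<noteq> 0"
    and infeasible: "\<And>v. p \<bullet> v = 0 \<Longrightarrow> \<exists>i. 0 \<le> v \<bullet> (Q i *v v)"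
  shows "\<exists>l. (\<forall>i. 0 \<le> l $ i) \<and> norm l = 1 \<and>
    (\<forall>v. p \<bullet> v = 0 \<longrightarrow> 0 \<le> v \<bullet> (matrix_aggregate Q l *v v))"
proof -
  let ?H = "{v. p \<bullet> v = 0}"
  let ?N = "{x :: real^'m. \<forall>i. x $ i < 0}"
  have "dim ?H + 1 = CARD('k)"
    using dim_hyperplane[OF p] by simp
  then have "convex (joint_form Q ` ?H)"
    using HHC subspace_hyperplane[of p]
    unfolding hidden_hyperplane_convex_def joint_form_def by blast
  moreover have "convex ?N"
    by (auto simp: convex_alt intro!: convex_bound_lt)
  moreover have "?N \<inter> joint_form Q ` ?H = {}"
    using infeasible by (fastforce simp: joint_form_def not_less[symmetric])
  moreover have "- 1 \<in> ?N" by simp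
  moreover have zero: "0 \<in> joint_form Q ` ?H"
    by (rule image_eqI[of _ _ 0]) (auto simp: joint_form_def vec_eq_iff)
  ultimately obtain a b where a: "a \<noteq> 0" "\<And>x. x \<in> ?N \<Longrightarrow> a \<bullet> x \<le> b"
      "\<And>x. x \<in> joint_form Q ` ?H \<Longrightarrow> b \<le> a \<bullet> x"
    using separating_hyperplane_sets[of ?N "joint_form Q ` ?H"] by blast
  have "b \<le> 0" using a(3)[OF zero] by simp
  then have nonneg: "0 \<le> b" "0 \<le> a $ i" for i
    using bounded_on_negative_orthant[of a b] a(2) by auto
  define l where "l = (1 / norm a) *\<^sub>R a"
  have "0 \<le> v \<bullet> (matrix_aggregate Q l *v v)" if "p \<bullet> v = 0" for v
  proof -
    have "0 \<le> a \<bullet> joint_form Q v" using a(3)[of "joint_form Q v"] nonneg(1) that by auto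
    then show ?thesis by (simp add: quadratic_form_aggregate l_def)
  qed
  moreover have "norm l = 1" "\<forall>i. 0 \<le> l $ i"
    using a(1) nonneg(2) by (auto simp: l_def)
  ultimately show ?thesis by blast
qed

section \<open>Homogeneous coordinates\<close>

definition homogenize :: "real^'n \<Rightarrow> real \<Rightarrow> real^('n option)"
  where "homogenize x t = (\<chi> r. case r of Some i \<Rightarrow> x $ i | None \<Rightarrow> t)"

lemma sum_UNIV_option:
  fixes g :: "'n::finite option \<Rightarrow> 'a::comm_monoid_add"
  shows "(\<Sum>r\<in>UNIV. g r) = g None + (\<Sum>i\<in>UNIV. g (Some i))"
  by (simp add: UNIV_option_conv sum.reindex)

lemma homogenize_nth [simp]:
  "homogenize x t $ Some i = x $ i" "homogenize x t $ None = t"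
  by (simp_all add: homogenize_def)

lemma inner_homogenize [simp]:
  "homogenize x s \<bullet> homogenize y t = x \<bullet> y + s * t"
  by (simp add: inner_vec_def sum_UNIV_option)

lemma homogenize_cases:
  obtains x where "v = homogenize x (v $ None)"
proof
  show "v = homogenize (\<chi> i. v $ Some i) (v $ None)"
    by (auto simp: homogenize_def vec_eq_iff split: option.split)
qed

lemma homogenize_add: "homogenize x s + homogenize y t = homogenize (x + y) (s + t)"
  and homogenize_scaleR: "r *\<^sub>R homogenize x t = homogenize (r *\<^sub>R x) (r * t)"
  by (auto simp: homogenize_def vec_eq_iff split: option.split)

lemma transpose_quadratic_matrix:
  assumes "transpose A = A"
  shows "transpose (quadratic_matrix A b c) = quadratic_matrix A b c"
proof -
  have "A $ i $ j = A $ j $ i" for i j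
    using arg_cong[OF assms, of "\<lambda>M. M $ j $ i"] by (simp add: transpose_def)
  then show ?thesis
    by (auto simp: transpose_def quadratic_matrix_def vec_eq_iff split: option.split)
qed

lemma quadratic_matrix_homogenize:
  "quadratic_matrix A b c *v homogenize x t = homogenize (A *v x + t *\<^sub>R b) (b \<bullet> x + t * c)"
proof -
  have "(quadratic_matrix A b c *v homogenize x t) $ r
      = homogenize (A *v x + t *\<^sub>R b) (b \<bullet> x + t * c) $ r" for r
    by (cases r) (simp_all add: quadratic_matrix_def matrix_vector_mult_def sum_UNIV_option
        inner_vec_def algebra_simps)
  then show ?thesis by (simp add: vec_eq_iff)
qed

lemma quadratic_form_homogenize:
  "homogenize x 1 \<bullet> (quadratic_matrix A b c *v homogenize x 1) = quadratic_fun A b c x"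
  by (simp add: quadratic_matrix_homogenize quadratic_fun_def inner_add_right inner_commute)

text \<open>Dehomogenisation.  A vector with last coordinate zero is a point at infinity; it is first
  moved off infinity along any \<open>z\<close> with \<open>a \<bullet> z = \<gamma>\<close>, which keeps it in the hyperplane.\<close>

lemma negative_on_hyperplane_imp_point:
  fixes A :: "'m::finite \<Rightarrow> real^'n^'n"
  assumes a: "a \<noteq> 0"
    and v: "homogenize a (- \<gamma>) \<bullet> v = 0"
    and neg: "\<And>i. v \<bullet> (quadratic_matrix (A i) (b i) (c i) *v v) < 0"
  shows "\<exists>x. a \<bullet> x = \<gamma> \<and> (\<forall>i. quadratic_fun (A i) (b i) (c i) x < 0)"
proof -
  let ?p = "homogenize a (- \<gamma>)" and ?M = "\<lambda>i. quadratic_matrix (A i) (b i) (c i)"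
  define z where "z = (\<gamma> / (a \<bullet> a)) *\<^sub>R a"
  have z: "a \<bullet> z = \<gamma>" using a by (simp add: z_def)
  have "\<exists>w. ?p \<bullet> w = 0 \<and> w $ None \<noteq> 0 \<and> (\<forall>i. w \<bullet> (?M i *v w) < 0)"
  proof (cases "v $ None = 0")
    case True
    let ?w = "\<lambda>s. v + s *\<^sub>R homogenize z 1"
    have "((\<lambda>s. ?w s \<bullet> (?M i *v ?w s)) \<longlongrightarrow> ?w 0 \<bullet> (?M i *v ?w 0)) (at_right 0)" for i
      by (intro tendsto_intros bounded_linear.tendsto[OF matrix_vector_mul_bounded_linear])
    then have "\<forall>\<^sub>F s in at_right 0. ?w s \<bullet> (?M i *v ?w s) < 0" for i
      by (rule order_tendstoD(2)) (use neg[of i] in simp)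
    then have "\<forall>\<^sub>F s in at_right 0. \<forall>i. ?w s \<bullet> (?M i *v ?w s) < 0"
      by (simp add: eventually_all_finite)
    moreover have "\<forall>\<^sub>F s in at_right (0::real). 0 < s"
      by (simp add: eventually_at_right_less)
    ultimately have "\<forall>\<^sub>F s in at_right 0. 0 < s \<and> (\<forall>i. ?w s \<bullet> (?M i *v ?w s) < 0)"
      by eventually_elim simp
    then obtain s where s: "0 < s" "\<forall>i. ?w s \<bullet> (?M i *v ?w s) < 0"
      using eventually_happens'[OF trivial_limit_at_right_real] by blast
    moreover have "?p \<bullet> ?w s = 0" using v z by (simp add: inner_add_right)
    moreover have "?w s $ None \<noteq> 0" using s True by simp
    ultimately show ?thesis by blast
  next
    case False
    then show ?thesis using v neg by blast
  qed
  then obtain w where w: "?p \<bullet> w = 0" "w $ None \<noteq> 0" "\<And>i. w \<bullet> (?M i *v w) < 0" by blast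
  define t where "t = w $ None"
  obtain x where x: "w = homogenize x t" using homogenize_cases t_def by metis
  have t: "t \<noteq> 0" using w t_def by simp
  let ?x = "(1/t) *\<^sub>R x"
  have wx: "w = t *\<^sub>R homogenize ?x 1" using x t by (simp add: homogenize_scaleR)
  have "a \<bullet> x = \<gamma> * t" using w(1) x by simp
  then have "a \<bullet> ?x = \<gamma>" using t by simp
  moreover have "quadratic_fun (A i) (b i) (c i) ?x < 0" for i
  proof -
    have "w \<bullet> (?M i *v w) = t\<^sup>2 * quadratic_fun (A i) (b i) (c i) ?x"
      unfolding quadratic_form_homogenize[symmetric]
      by (subst (1 2) wx) (rule quadratic_form_scaleR)
    then show ?thesis using w(3)[of i] t by (simp add: mult_less_0_iff)
  qed
  ultimately show ?thesis by blast
qed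

section \<open>Multipliers for a hyperplane bounding the feasible set\<close>

text \<open>The hyperplane at level \<open>\<gamma>\<close> misses the feasible set, so all of it
  lies in the part of \<open>{x. f\<^sub>\<lambda> x \<le> 0}\<close> strictly on one side, and this part is convex.\<close>

lemma exists_multiplier_of_strict_separation:
  fixes A :: "'m::finite \<Rightarrow> real^'n^'n" and b :: "'m \<Rightarrow> real^'n" and c :: "'m \<Rightarrow> real"
  defines "Q \<equiv> \<lambda>i. quadratic_matrix (A i) (b i) (c i)"
    and "f \<equiv> \<lambda>i. quadratic_fun (A i) (b i) (c i)"
  assumes A_sym: "\<And>i. transpose (A i) = A i"
    and HHC: "hidden_hyperplane_convex Q"
    and a: "a \<noteq> 0"
    and sep: "\<And>x. (\<forall>i. f i x \<le> 0) \<Longrightarrow> a \<bullet> x < \<gamma>"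
  shows "\<exists>l. (\<forall>i. 0 \<le> l $ i) \<and> norm l = 1 \<and>
    (\<forall>v. homogenize a (- \<gamma>) \<bullet> v = 0 \<longrightarrow> 0 \<le> v \<bullet> (matrix_aggregate Q l *v v)) \<and>
    (\<forall>x \<in> closure (convex hull {x. \<forall>i. f i x \<le> 0}). l \<bullet> (\<chi> i. f i x) \<le> 0)"
proof -
  let ?p = "homogenize a (- \<gamma>)"
  have p: "?p \<noteq> 0"
    using a by (metis homogenize_nth(1) vec_eq_iff zero_index)
  have "\<exists>i. 0 \<le> v \<bullet> (Q i *v v)" if "?p \<bullet> v = 0" for v
  proof (rule ccontr)
    assume "\<not> ?thesis"
    then have "\<And>i. v \<bullet> (quadratic_matrix (A i) (b i) (c i) *v v) < 0"
      by (auto simp: Q_def not_le)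
    from negative_on_hyperplane_imp_point[OF a \<open>?p \<bullet> v = 0\<close> this]
    show False using sep by (force simp: f_def intro: less_imp_le)
  qed
  from exists_aggregate_psd_on_hyperplane[OF HHC p this]
  obtain l where l: "\<forall>i. 0 \<le> l $ i" "norm l = 1"
    and psd: "\<And>v. ?p \<bullet> v = 0 \<Longrightarrow> 0 \<le> v \<bullet> (matrix_aggregate Q l *v v)" by blast
  let ?M = "matrix_aggregate Q l" and ?h = "\<lambda>x. homogenize x 1"
  have sym: "transpose ?M = ?M"
    unfolding Q_def by (intro transpose_matrix_aggregate transpose_quadratic_matrix A_sym)
  have form: "?h x \<bullet> (?M *v ?h x) = l \<bullet> (\<chi> i. f i x)" for x
    by (simp add: quadratic_form_aggregate joint_form_def Q_def f_def quadratic_form_homogenize)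
  let ?C = "{x. a \<bullet> x < \<gamma> \<and> ?h x \<bullet> (?M *v ?h x) \<le> 0}"
  have "convex ?C"
  proof (rule convexI)
    fix x y and r s :: real
    assume x: "x \<in> ?C" and y: "y \<in> ?C" and rs: "0 \<le> r" "0 \<le> s" "r + s = 1"
    have side: "a \<bullet> (r *\<^sub>R x + s *\<^sub>R y) < \<gamma>"
      using x y rs by (simp add: inner_add_right convex_bound_lt)
    have cross: "?h x \<bullet> (?M *v ?h y) \<le> 0"
      by (rule psd_on_hyperplane_same_side[OF sym psd]) (use x y in auto)
    have "?h (r *\<^sub>R x + s *\<^sub>R y) = r *\<^sub>R ?h x + s *\<^sub>R ?h y"
      using rs by (simp add: homogenize_scaleR homogenize_add)
    then have "?h (r *\<^sub>R x + s *\<^sub>R y) \<bullet> (?M *v ?h (r *\<^sub>R x + s *\<^sub>R y)) =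
        r\<^sup>2 * (?h x \<bullet> (?M *v ?h x)) + 2 * (s * (r * (?h x \<bullet> (?M *v ?h y))))
        + s\<^sup>2 * (?h y \<bullet> (?M *v ?h y))"
      using quadratic_form_add[OF sym, of "r *\<^sub>R ?h x" s "?h y"]
      by (simp add: matrix_vector_mult_scaleR power2_eq_square mult.assoc)
    also have "\<dots> \<le> 0 + 2 * 0 + 0"
      using x y rs cross
      by (intro add_mono mult_left_mono mult_nonneg_nonpos) auto
    finally show "r *\<^sub>R x + s *\<^sub>R y \<in> ?C" using side by simp
  qed
  moreover have "{x. \<forall>i. f i x \<le> 0} \<subseteq> ?C"
  proof clarify
    fix x assume x: "\<forall>i. f i x \<le> 0"
    have "l \<bullet> (\<chi> i. f i x) \<le> 0"
      unfolding inner_vec_def using l x by (auto intro!: sum_nonpos mult_nonneg_nonpos)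
    then show "a \<bullet> x < \<gamma> \<and> ?h x \<bullet> (?M *v ?h x) \<le> 0"
      using sep x form by simp
  qed
  ultimately have hull: "convex hull {x. \<forall>i. f i x \<le> 0} \<subseteq> ?C"
    by (simp add: hull_minimal)
  have cont: "continuous_on UNIV (\<lambda>x. l \<bullet> (\<chi> i. f i x))"
    unfolding f_def quadratic_fun_def
    by (intro continuous_intros linear_continuous_on_compose[OF continuous_on_id]
        matrix_vector_mul_linear)
  have "closed {x. l \<bullet> (\<chi> i. f i x) \<le> 0}"
    by (rule closed_Collect_le[OF cont]) simp
  then have "closure (convex hull {x. \<forall>i. f i x \<le> 0}) \<subseteq> {x. l \<bullet> (\<chi> i. f i x) \<le> 0}"
    using hull form by (intro closure_minimal) auto
  then show ?thesis using l psd by blast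
qed

text \<open>The levels \<open>\<beta> + 1/(k+1)\<close> are strictly separated from the feasible set, and both
  conclusions survive passing to a limit of normalised multipliers.\<close>

lemma exists_multiplier_of_separation:
  fixes A :: "'m::finite \<Rightarrow> real^'n^'n" and b :: "'m \<Rightarrow> real^'n" and c :: "'m \<Rightarrow> real"
  defines "Q \<equiv> \<lambda>i. quadratic_matrix (A i) (b i) (c i)"
    and "f \<equiv> \<lambda>i. quadratic_fun (A i) (b i) (c i)"
  assumes A_sym: "\<And>i. transpose (A i) = A i"
    and HHC: "hidden_hyperplane_convex Q"
    and a: "a \<noteq> 0"
    and sep: "\<And>x. (\<forall>i. f i x \<le> 0) \<Longrightarrow> a \<bullet> x \<le> \<beta>"
  shows "\<exists>l. (\<forall>i. 0 \<le> l $ i) \<and> l \<noteq> 0 \<and>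
    (\<forall>v. homogenize a (- \<beta>) \<bullet> v = 0 \<longrightarrow> 0 \<le> v \<bullet> (matrix_aggregate Q l *v v)) \<and>
    (\<forall>x \<in> closure (convex hull {x. \<forall>i. f i x \<le> 0}). l \<bullet> (\<chi> i. f i x) \<le> 0)"
proof -
  define \<gamma> where "\<gamma> k = \<beta> + inverse (real (Suc k))" for k
  define mult where "mult \<delta> l \<longleftrightarrow> (\<forall>i. 0 \<le> l $ i) \<and> norm l = 1 \<and>
    (\<forall>v. homogenize a (- \<delta>) \<bullet> v = 0 \<longrightarrow> 0 \<le> v \<bullet> (matrix_aggregate Q l *v v)) \<and>
    (\<forall>x \<in> closure (convex hull {x. \<forall>i. f i x \<le> 0}). l \<bullet> (\<chi> i. f i x) \<le> 0)" for \<delta> l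
  have "\<exists>l. mult (\<gamma> k) l" for k
    unfolding mult_def Q_def f_def
  proof (rule exists_multiplier_of_strict_separation[OF A_sym HHC[unfolded Q_def] a])
    fix x assume "\<forall>i. quadratic_fun (A i) (b i) (c i) x \<le> 0"
    then have "a \<bullet> x \<le> \<beta>" by (simp add: sep f_def)
    moreover have "\<beta> < \<gamma> k" by (simp add: \<gamma>_def)
    ultimately show "a \<bullet> x < \<gamma> k" by (rule le_less_trans)
  qed
  then obtain L where "\<And>k. mult (\<gamma> k) (L k)" by metis
  then have L: "\<And>k i. 0 \<le> L k $ i" "\<And>k. norm (L k) = 1"
    and psd: "\<And>k v. homogenize a (- \<gamma> k) \<bullet> v = 0 \<Longrightarrow>
      0 \<le> v \<bullet> (matrix_aggregate Q (L k) *v v)"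
    and nonpos: "\<And>k x. x \<in> closure (convex hull {x. \<forall>i. f i x \<le> 0}) \<Longrightarrow>
      L k \<bullet> (\<chi> i. f i x) \<le> 0"
    unfolding mult_def by blast+
  have "\<forall>k. L k \<in> sphere 0 1" using L(2) by simp
  then obtain l r where l: "l \<in> sphere 0 1" and r: "strict_mono r" and "(L \<circ> r) \<longlonglongrightarrow> l"
    using compact_sphere[of 0 1, unfolded compact_def] by metis
  then have lim: "(\<lambda>k. L (r k)) \<longlonglongrightarrow> l" by (simp add: o_def)
  show ?thesis
  proof (intro exI[of _ l] conjI allI impI ballI)
    show "0 \<le> l $ i" for i
      using LIMSEQ_le_const[OF tendsto_vec_nth[OF lim]] L(1) by blast
    show "l \<noteq> 0" using l by auto
    show "l \<bullet> (\<chi> i. f i x) \<le> 0" if "x \<in> closure (convex hull {x. \<forall>i. f i x \<le> 0})" for x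
      using LIMSEQ_le_const2[OF tendsto_inner[OF lim tendsto_const]] nonpos[OF that] by blast
    show "0 \<le> v \<bullet> (matrix_aggregate Q l *v v)" if v: "homogenize a (- \<beta>) \<bullet> v = 0" for v
    proof -
      \<comment> \<open>Shift \<open>v\<close> along \<open>a\<close> into the hyperplane at level \<open>\<gamma> k\<close>.\<close>
      define z where "z = homogenize ((1 / (a \<bullet> a)) *\<^sub>R a) 0"
      define w where "w k = v + (inverse (real (Suc k)) * v $ None) *\<^sub>R z" for k
      obtain x where x: "v = homogenize x (v $ None)" by (rule homogenize_cases)
      have ax: "a \<bullet> x = \<beta> * v $ None" using v by (subst (asm) x) simp
      have "homogenize a (- \<gamma> k) \<bullet> w k = 0" for k
      proof -
        have "homogenize a (- \<gamma> k) \<bullet> v = - inverse (real (Suc k)) * v $ None"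
          by (subst x) (simp add: ax \<gamma>_def algebra_simps)
        moreover have "homogenize a (- \<gamma> k) \<bullet> z = 1" using a by (simp add: z_def)
        ultimately show ?thesis by (simp add: w_def inner_add_right)
      qed
      then have ge: "0 \<le> L (r k) \<bullet> joint_form Q (w (r k))" for k
        using psd by (simp flip: quadratic_form_aggregate)
      have "w \<longlonglongrightarrow> v + (0 * v $ None) *\<^sub>R z"
        unfolding w_def by (intro tendsto_intros LIMSEQ_inverse_real_of_nat)
      then have "(\<lambda>k. w (r k)) \<longlonglongrightarrow> v"
        using LIMSEQ_subseq_LIMSEQ[OF _ r] by (force simp: o_def)
      then have "(\<lambda>k. joint_form Q (w (r k))) \<longlonglongrightarrow> joint_form Q v"
        unfolding joint_form_def
        by (intro tendsto_intros bounded_linear.tendsto[OF matrix_vector_mul_bounded_linear])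
      from LIMSEQ_le_const[OF tendsto_inner[OF lim this]] show ?thesis
        using ge by (auto simp: quadratic_form_aggregate)
    qed
  qed
qed

section \<open>The interior of the closed convex hull as an intersection of aggregates\<close>

theorem theorem2p24:
  fixes A :: "'m::finite \<Rightarrow> real^'n^'n"
    and b :: "'m \<Rightarrow> real^'n"
    and c :: "'m \<Rightarrow> real"
    and f :: "'m \<Rightarrow> real^'n \<Rightarrow> real"
    and Q :: "'m \<Rightarrow> real^('n option)^('n option)"
    and T G :: "(real^'n) set"
    and \<Omega> :: "(real^'m) set"
  assumes n: "CARD('n) \<ge> 3"
    and m: "CARD('m) \<ge> 2"
    and A_sym: "\<And>i. transpose (A i) = A i"
    and f_def: "f = (\<lambda>i. quadratic_fun (A i) (b i) (c i))"
    and Q_def: "Q = (\<lambda>i. quadratic_matrix (A i) (b i) (c i))"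
    and T_def: "T = {x. \<forall>i. f i x \<le> 0}"
    and G_def: "G = interior (closure (convex hull T))"
    and HHC: "hidden_hyperplane_convex Q"
    and G_nonempty: "G \<noteq> {}"
    and G_proper: "G \<noteq> UNIV"
    and Q_nonzero: "\<And>l. (\<forall>i. 0 \<le> l $ i) \<Longrightarrow> l \<noteq> 0 \<Longrightarrow> matrix_aggregate Q l \<noteq> 0"
    and \<Omega>_def: "\<Omega> = {l. (\<forall>i. 0 \<le> l $ i) \<and> l \<noteq> 0 \<and>
      num_neg_eigenvalues (matrix_aggregate Q l) \<le> 1 \<and> G \<subseteq> aggregate_set f l}"
  shows "G = (\<Inter>l\<in>\<Omega>. aggregate_set f l)"
proof
  show "G \<subseteq> (\<Inter>l\<in>\<Omega>. aggregate_set f l)" by (auto simp: \<Omega>_def)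
  show "(\<Inter>l\<in>\<Omega>. aggregate_set f l) \<subseteq> G"
  proof (rule ccontr)
    assume "\<not> ?thesis"
    then obtain y where y: "y \<notin> G" and y_all: "\<And>l. l \<in> \<Omega> \<Longrightarrow> y \<in> aggregate_set f l"
      by blast
    let ?C = "closure (convex hull T)" and ?h = "\<lambda>x::real^'n. homogenize x 1"
    have "convex ?C" by (simp add: convex_closure)
    then have "convex G" "open G" "?C = closure G"
      using convex_closure_interior[of ?C] G_nonempty by (auto simp: G_def)
    then obtain a d where a: "a \<noteq> 0" and d: "\<And>x. x \<in> G \<Longrightarrow> a \<bullet> x \<le> d" "d \<le> a \<bullet> y"
      using separating_hyperplane_sets[of G "{y}"] y G_nonempty by auto
    define \<beta> where "\<beta> = a \<bullet> y"
    have "G \<subseteq> {x. a \<bullet> x \<le> \<beta>}" using d by (force simp: \<beta>_def)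
    then have "?C \<subseteq> {x. a \<bullet> x \<le> \<beta>}" and "G \<subseteq> interior {x. a \<bullet> x \<le> \<beta>}"
      using \<open>?C = closure G\<close> \<open>open G\<close>
      by (simp_all add: closure_minimal closed_halfspace_le interior_maximal)
    then have aC: "\<And>x. x \<in> ?C \<Longrightarrow> a \<bullet> x \<le> \<beta>" and aG: "\<And>x. x \<in> G \<Longrightarrow> a \<bullet> x < \<beta>"
      using interior_halfspace_le[OF a] by auto
    have sep: "a \<bullet> x \<le> \<beta>" if "\<forall>i. quadratic_fun (A i) (b i) (c i) x \<le> 0" for x
      using that aC closure_subset[of "convex hull T"] hull_subset[of T convex]
      by (auto simp: T_def f_def)
    let ?p = "homogenize a (- \<beta>)"
    have "\<exists>l. (\<forall>i. 0 \<le> l $ i) \<and> l \<noteq> 0 \<and>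
        (\<forall>v. ?p \<bullet> v = 0 \<longrightarrow> 0 \<le> v \<bullet> (matrix_aggregate Q l *v v)) \<and>
        (\<forall>x \<in> ?C. l \<bullet> (\<chi> i. f i x) \<le> 0)"
      unfolding Q_def T_def f_def
      by (rule exists_multiplier_of_separation[OF A_sym HHC[unfolded Q_def] a sep])
    then obtain l where l: "\<And>i. 0 \<le> l $ i" "l \<noteq> 0"
      and psd: "\<And>v. ?p \<bullet> v = 0 \<Longrightarrow> 0 \<le> v \<bullet> (matrix_aggregate Q l *v v)"
      and nonpos: "\<And>x. x \<in> ?C \<Longrightarrow> l \<bullet> (\<chi> i. f i x) \<le> 0"
      by blast
    let ?M = "matrix_aggregate Q l"
    have sym: "transpose ?M = ?M"
      unfolding Q_def by (intro transpose_matrix_aggregate transpose_quadratic_matrix A_sym)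
    have form: "?h x \<bullet> (?M *v ?h x) = l \<bullet> (\<chi> i. f i x)" for x
      by (simp add: quadratic_form_aggregate joint_form_def Q_def f_def quadratic_form_homogenize)
    have agg: "x \<in> aggregate_set f l \<longleftrightarrow> l \<bullet> (\<chi> i. f i x) < 0" for x
      by (simp add: aggregate_set_def inner_vec_def)
    have GC: "G \<subseteq> ?C" by (simp add: G_def interior_subset)
    have "G \<subseteq> aggregate_set f l"
    proof (rule subsetI, rule ccontr)
      fix x assume x: "x \<in> G" "x \<notin> aggregate_set f l"
      then have zero: "?h x \<bullet> (?M *v ?h x) = 0"
        using nonpos[of x] GC agg form by fastforce
      \<comment> \<open>The cone over \<open>G\<close> in the half-space \<open>t > 0\<close> is an open set on which the form is
        nonpositive.\<close>
      let ?U = "{v. 0 < v $ None} \<inter> (\<lambda>v. (1 / v $ None) *\<^sub>R (\<chi> i. v $ Some i)) -` G"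
      have half: "open {v :: real^('n option). 0 < v $ None}"
        by (intro open_Collect_less continuous_intros)
      then have "open ?U"
        using \<open>open G\<close>
        by (intro continuous_open_preimage continuous_intros) auto
      moreover have "?h x \<in> ?U" using x by simp
      moreover have "w \<bullet> (?M *v w) \<le> 0" if w: "w \<in> ?U" for w
      proof -
        define t where "t = w $ None"
        define z :: "real^'n" where "z = (1 / t) *\<^sub>R (\<chi> i. w $ Some i)"
        have "t \<noteq> 0" "z \<in> G" using w by (auto simp: t_def z_def)
        then have "w $ r = (t *\<^sub>R ?h z) $ r" for r
          by (cases r) (auto simp: t_def z_def)
        then have wz: "w = t *\<^sub>R ?h z" unfolding vec_eq_iff by blast
        have "w \<bullet> (?M *v w) = t\<^sup>2 * (?h z \<bullet> (?M *v ?h z))"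
          unfolding wz by (rule quadratic_form_scaleR)
        moreover have "?h z \<bullet> (?M *v ?h z) \<le> 0"
          using \<open>z \<in> G\<close> nonpos[of z] GC form[of z] by auto
        ultimately show ?thesis by (simp add: mult_nonneg_nonpos)
      qed
      moreover have "?p \<bullet> ?h x \<noteq> 0" using aG[OF x(1)] by simp
      ultimately have "?M = 0"
        using psd_on_hyperplane_local_max_imp_zero[OF sym psd _ zero] by blast
      then show False using Q_nonzero l by blast
    qed
    then have "l \<in> \<Omega>"
      using l psd_on_hyperplane_num_neg_eigenvalues[OF sym psd] by (simp add: \<Omega>_def)
    then have "l \<bullet> (\<chi> i. f i y) < 0" using y_all agg by blast
    moreover have "0 \<le> ?h y \<bullet> (?M *v ?h y)" by (rule psd) (simp add: \<beta>_def)
    ultimately show False using form by simp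
  qed
qed

end
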